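(* Let $n\geq 3$. Let $H$ be either a non-transitive subgroup of $\operatorname{Sym}_n$ or an abelian subgroup of $\operatorname{Sym}_n$ such that $(1,2,\dots,n)\notin H$. Let $S=S_n(H)$ and let $r$ be a positive integer. (i) If $m_1,\dots,m_r\geq 3$ and $1\leq i_1,\dots,i_r\leq n$, then $\bigcup_{j=1}^r Sa_{i_j}^{m_j}S$ is a prime ideal of $S$. (ii) For every $m\geq 1$, $Sz^mS$ is a prime ideal of $S$. (iii) If $m_1,\dots,m_r\geq 3$, $1\leq i_1,\dots,i_r\leq n$ and $m\geq 1$, then $(Sz^mS)\cup\bigcup_{j=1}^r Sa_{i_j}^{m_j}S$ is a prime ideal of $S$.
   Context: $S_n(H)$ is the monoid with presentation $\langle a_1,\dots,a_n \mid a_1\cdots a_n = a_{\sigma(1)}\cdots a_{\sigma(n)},\ \sigma\in H\rangle$, and $z=a_1a_2\cdots a_n$. An ideal $Q$ of a monoid $S$ is prime if $Q\neq S$ and, for $u,v\in S$, $uSv\subseteq Q$ implies $u\in Q$ or $v\in Q$. *)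

theory Defs
  imports "HOL-Algebra.Sym_Groups"
begin

text \<open>Elements of the free monoid on a_1,...,a_n are words (lists) over the alphabet {1..n};
  letter i stands for the generator a_i.  The monoid S_n(H) is the quotient of the free
  monoid by the congruence generated by a_1...a_n = a_sigma(1)...a_sigma(n), sigma in H.
  Subsets of S_n(H) are represented by congruence-saturated sets of words.\<close>

definition words :: "nat \<Rightarrow> nat list set" where
  "words n = lists {1..n}"

definition zword :: "nat \<Rightarrow> nat list" where
  "zword n = [1..<n+1]"

inductive scong :: "nat \<Rightarrow> (nat \<Rightarrow> nat) set \<Rightarrow> nat list \<Rightarrow> nat list \<Rightarrow> bool"
  for n H where
  srefl: "scong n H w w"
| ssym: "scong n H u w \<Longrightarrow> scong n H w u"
| strans: "scong n H u v \<Longrightarrow> scong n H v w \<Longrightarrow> scong n H u w"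
| sstep: "\<sigma> \<in> H \<Longrightarrow> scong n H (u @ zword n @ v) (u @ map \<sigma> (zword n) @ v)"

definition pideal :: "nat \<Rightarrow> (nat \<Rightarrow> nat) set \<Rightarrow> nat list \<Rightarrow> nat list set" where
  "pideal n H w = {u \<in> words n. \<exists>x \<in> words n. \<exists>y \<in> words n. scong n H u (x @ w @ y)}"

definition is_ideal :: "nat \<Rightarrow> (nat \<Rightarrow> nat) set \<Rightarrow> nat list set \<Rightarrow> bool" where
  "is_ideal n H Q \<longleftrightarrow> Q \<subseteq> words n
     \<and> (\<forall>u \<in> Q. \<forall>w \<in> words n. scong n H u w \<longrightarrow> w \<in> Q)
     \<and> (\<forall>u \<in> Q. \<forall>x \<in> words n. \<forall>y \<in> words n. x @ u @ y \<in> Q)"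

definition prime_ideal :: "nat \<Rightarrow> (nat \<Rightarrow> nat) set \<Rightarrow> nat list set \<Rightarrow> bool" where
  "prime_ideal n H Q \<longleftrightarrow> is_ideal n H Q \<and> Q \<noteq> words n
     \<and> (\<forall>u \<in> words n. \<forall>v \<in> words n.
           (\<forall>s \<in> words n. u @ s @ v \<in> Q) \<longrightarrow> u \<in> Q \<or> v \<in> Q)"

definition transitive_on :: "nat \<Rightarrow> (nat \<Rightarrow> nat) set \<Rightarrow> bool" where
  "transitive_on n H \<longleftrightarrow> (\<forall>i \<in> {1..n}. \<forall>j \<in> {1..n}. \<exists>\<sigma> \<in> H. \<sigma> i = j)"

definition long_cycle :: "nat \<Rightarrow> nat \<Rightarrow> nat" where
  "long_cycle n i = (if 1 \<le> i \<and> i < n then i + 1 else if i = n then 1 else i)"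

end

theory Submission
  imports Defs
begin

text \<open>An ideal \<open>Q\<close> as in the theorem consists of the words some representative of which contains a
  forbidden factor, namely a cube or higher power of a letter or a product of relators. Given words \<open>u\<close> and \<open>v\<close>
  outside \<open>Q\<close>, extend \<open>u\<close> to the right to a word outside \<open>Q\<close> all of whose representatives end in a
  fixed square \<open>yy\<close>, extend \<open>v\<close> to the left to one all of whose representatives begin with a fixed
  square \<open>xx\<close>, and put \<open>cc\<close> in between, where \<open>c\<close> is a third letter. Relators have distinct letters
  and length at least 3, so none of them can meet \<open>cc\<close>: the two sides are rewritten independently,
  and no forbidden factor arises.

  The extension to the right is easy when some letter is never the last letter of a relator, as
  happens if \<open>H\<close> is not transitive. If \<open>H\<close> is abelian and transitive, it acts regularly, so a relator
  is determined by its last letter, and each letter of a relator determines the next one through a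
  permutation that depends only on the position. In this case the monoid is right cancellative. Moreover, no word
  representing an element of \<open>Sz\<close> stays in \<open>Sz\<close> after appending one letter; otherwise all the
  successor permutations would coincide, which forces the long cycle into \<open>H\<close>. The extension to the left is
  the extension to the right for the reversed relators.\<close>

section \<open>The congruence as free exchange of relators\<close>

definition rstep :: "'a list set \<Rightarrow> 'a list \<Rightarrow> 'a list \<Rightarrow> bool" where
  "rstep R u v \<longleftrightarrow> (\<exists>p a b q. a \<in> R \<and> b \<in> R \<and> u = p @ a @ q \<and> v = p @ b @ q)"

abbreviation wcong :: "'a list set \<Rightarrow> 'a list \<Rightarrow> 'a list \<Rightarrow> bool" where
  "wcong R \<equiv> (rstep R)\<^sup>*\<^sup>*"

lemma wcong_sym: "wcong R u v \<Longrightarrow> wcong R v u"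
proof -
  have "symp (rstep R)" unfolding rstep_def symp_def by metis
  then show "wcong R u v \<Longrightarrow> wcong R v u" using symp_rtranclp sympD by metis
qed

lemma wcong_context:
  assumes "wcong R u v" shows "wcong R (x @ u @ y) (x @ v @ y)"
  using assms
proof induction
  case (step v w)
  have "rstep R (x @ v @ y) (x @ w @ y)"
  proof -
    obtain p a b q where "a \<in> R" "b \<in> R" "v = p @ a @ q" "w = p @ b @ q"
      using step.hyps unfolding rstep_def by blast
    then have "a \<in> R \<and> b \<in> R \<and> x @ v @ y = (x @ p) @ a @ (q @ y) \<and> x @ w @ y = (x @ p) @ b @ (q @ y)"
      by simp
    then show ?thesis unfolding rstep_def by blast
  qed
  then show ?case using step.IH by simp
qed simp

lemma wcong_appendR: "wcong R u v \<Longrightarrow> wcong R (u @ y) (v @ y)"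
  using wcong_context[of R u v "[]" y] by simp

lemma wcong_appendL: "wcong R u v \<Longrightarrow> wcong R (x @ u) (x @ v)"
  using wcong_context[of R u v x "[]"] by simp

lemma wcong_relators: "a \<in> R \<Longrightarrow> b \<in> R \<Longrightarrow> wcong R a b"
  unfolding rstep_def by (rule r_into_rtranclp) (metis append_Nil append_Nil2)

lemma rstep_rev: "rstep R u v \<Longrightarrow> rstep (rev ` R) (rev u) (rev v)"
  unfolding rstep_def by (clarsimp) (metis append.assoc image_eqI rev_append)

lemma wcong_rev:
  "wcong R u v \<Longrightarrow> wcong (rev ` R) (rev u) (rev v)"
  by (induction rule: rtranclp_induct) (auto intro: rstep_rev rtranclp.rtrancl_into_rtrancl)

lemma rev_rev_image: "rev ` rev ` R = R"
  by (simp add: image_image)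

section \<open>Ideals described by forbidden factors\<close>

definition ends_in :: "'a list set \<Rightarrow> 'a list \<Rightarrow> bool" where
  "ends_in R u \<longleftrightarrow> (\<exists>r. \<exists>a\<in>R. wcong R u (r @ a))"

text \<open>In the monoid where all relators in \<open>R\<close> are identified with one element z,
  this is membership in the two-sided ideal generated by \<open>F\<close>, just as
  \<open>ends_in\<close> is membership in the left ideal Sz.\<close>

definition hits :: "'a list set \<Rightarrow> 'a list set \<Rightarrow> 'a list \<Rightarrow> bool" where
  "hits R F u \<longleftrightarrow> (\<exists>f\<in>F. \<exists>x y. wcong R u (x @ f @ y))"

text \<open>All relators represent z, so a product of arbitrary relators stands for a power of z
  without singling out one word. In this form the condition is inherited by the reversed
  relators.\<close>

definition admissible :: "'a list set \<Rightarrow> 'a list set \<Rightarrow> bool" where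
  "admissible R F \<longleftrightarrow> (\<forall>f\<in>F. (\<exists>m\<ge>3. \<exists>x. f = replicate m x) \<or>
      (\<exists>ws. ws \<noteq> [] \<and> set ws \<subseteq> R \<and> f = concat ws))"

text \<open>\<open>F\<close> is quantified here because the left extension applies the same property
  to the reversed relators together with the reversed \<open>F\<close>.\<close>

definition extendable :: "'a set \<Rightarrow> 'a list set \<Rightarrow> bool" where
  "extendable A R \<longleftrightarrow> (\<forall>F u. admissible R F \<and> u \<in> lists A \<and> \<not> hits R F u \<longrightarrow>
     (\<exists>p\<in>lists A. \<not> hits R F (u @ p) \<and>
        (\<exists>y\<in>A. \<forall>w. wcong R (u @ p) w \<longrightarrow> (\<exists>t. w = t @ [y, y]))))"

lemma hits_cong: "wcong R u v \<Longrightarrow> hits R F u \<longleftrightarrow> hits R F v"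
  unfolding hits_def by (meson wcong_sym rtranclp_trans)

lemma hits_rev: "hits R F u \<Longrightarrow> hits (rev ` R) (rev ` F) (rev u)"
proof -
  assume "hits R F u"
  then obtain f x y where f: "f \<in> F" "wcong R u (x @ f @ y)" unfolding hits_def by blast
  have "wcong (rev ` R) (rev u) (rev y @ rev f @ rev x)" using wcong_rev[OF f(2)] by simp
  then show "hits (rev ` R) (rev ` F) (rev u)" unfolding hits_def using f(1) by blast
qed

lemma hits_rev_iff: "hits (rev ` R) (rev ` F) (rev u) \<longleftrightarrow> hits R F u"
  using hits_rev[of R F u] hits_rev[of "rev ` R" "rev ` F" "rev u"] by (auto simp: rev_rev_image)

lemma admissible_rev:
  assumes "admissible R F" shows "admissible (rev ` R) (rev ` F)"
  unfolding admissible_def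
proof
  fix g assume "g \<in> rev ` F"
  then obtain f where f: "f \<in> F" "g = rev f" by blast
  consider m x where "m \<ge> 3" "f = replicate m x" | ws where "ws \<noteq> []" "set ws \<subseteq> R" "f = concat ws"
    using assms f(1) unfolding admissible_def by blast
  then show "(\<exists>m\<ge>3. \<exists>x. g = replicate m x) \<or> (\<exists>ws. ws \<noteq> [] \<and> set ws \<subseteq> rev ` R \<and> g = concat ws)"
  proof cases
    case 1 then show ?thesis using f by auto
  next
    case 2
    then have "map rev (rev ws) \<noteq> [] \<and> set (map rev (rev ws)) \<subseteq> rev ` R \<and> g = concat (map rev (rev ws))"
      using f by (auto simp: rev_concat rev_map)
    then show ?thesis by blast
  qed
qed

section \<open>Words kept apart by a separating factor\<close>

lemma append_eq_snoc: "p @ a = u @ [y] \<Longrightarrow> a \<noteq> [] \<Longrightarrow> u = p @ butlast a \<and> last a = y"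
  by (cases a rule: rev_cases) auto

lemma append_split:
  "x @ y = c @ d \<Longrightarrow> length c \<le> length x \<Longrightarrow> \<exists>t. x = c @ t \<and> d = t @ y"
  by (auto simp: append_eq_append_conv2)

text \<open>By \<open>sep\<close>, every relator occurring in a word reached so far lies entirely to
  the left or entirely to the right of \<open>M\<close>. Each exchange thus changes one side only,
  and the shape of the word persists.\<close>

lemma wcong_sandwich:
  assumes sep: "\<And>U' V' p a q. wcong R U U' \<Longrightarrow> wcong R V V' \<Longrightarrow> a \<in> R \<Longrightarrow> U' @ M @ V' = p @ a @ q
      \<Longrightarrow> length (p @ a) \<le> length U' \<or> length (U' @ M) \<le> length p"
    and "wcong R (U @ M @ V) W"
  shows "\<exists>U' V'. wcong R U U' \<and> wcong R V V' \<and> W = U' @ M @ V'"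
  using assms(2)
proof induction
  case base
  show ?case by blast
next
  case (step W W')
  obtain U' V' where UV: "wcong R U U'" "wcong R V V'" "W = U' @ M @ V'" using step.IH by blast
  obtain p a b q where pq: "a \<in> R" "b \<in> R" "W = p @ a @ q" "W' = p @ b @ q"
    using step.hyps(2) unfolding rstep_def by blast
  have ab: "wcong R (x @ a @ y) (x @ b @ y)" for x y by (intro wcong_context wcong_relators pq)
  from sep[OF UV(1,2) pq(1)] UV(3) pq(3)
  consider "length (p @ a) \<le> length U'" | "length (U' @ M) \<le> length p" by metis
  then show ?case
  proof cases
    case 1
    then obtain t where t: "U' = p @ a @ t" "q = t @ M @ V'"
      using append_split[of U' "M @ V'" "p @ a" q] UV pq by auto
    then have "W' = (p @ b @ t) @ M @ V'" "wcong R U (p @ b @ t)"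
      using pq UV(1) ab by (auto intro: rtranclp_trans)
    then show ?thesis using UV by blast
  next
    case 2
    then obtain t where t: "p = (U' @ M) @ t" "V' = t @ a @ q"
      using append_split[of p "a @ q" "U' @ M" V'] UV pq by auto
    then have "W' = U' @ M @ t @ b @ q" "wcong R V (t @ b @ q)"
      using pq UV(2) ab by (auto intro: rtranclp_trans)
    then show ?thesis using UV by blast
  qed
qed

text \<open>A factor with distinct letters cannot cross the middle of any of the three squares.
  Between two neighbouring middles there is room for only two letters, so a factor of length at
  least 3 lies left of the middle of \<open>yy\<close> or right of that of \<open>xx\<close>, apart
  from overhanging outer letters that still avoid \<open>cc\<close>.\<close>

lemma squares_separate_distinct:
  assumes "distinct a" "length a \<ge> 3" "t @ [y, y, c, c, x, x] @ t' = p @ a @ q"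
  shows "length p + length a \<le> length t + 2 \<or> length t + 4 \<le> length p"
proof (rule ccontr)
  let ?W = "t @ [y, y, c, c, x, x] @ t'"
  assume N: "\<not> ?thesis"
  have W: "?W ! (length t) = y" "?W ! (length t + 1) = y" "?W ! (length t + 2) = c"
    "?W ! (length t + 3) = c" "?W ! (length t + 4) = x" "?W ! (length t + 5) = x"
    by (simp_all add: nth_append)
  have nb: "?W ! i \<noteq> ?W ! (i + 1)" if "length p \<le> i" "i + 1 < length p + length a" for i
  proof -
    have "i - length p < length a" "i + 1 - length p < length a" "i - length p \<noteq> i + 1 - length p"
      using that by linarith+
    then show ?thesis unfolding assms(3) using that assms(1)
      by (simp add: nth_append nth_eq_iff_index_eq)
  qed
  have e: "length t + 2 + 1 = length t + 3" "length t + 4 + 1 = length t + 5" by simp_all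
  have "\<not> (length p \<le> length t \<and> length t + 1 < length p + length a)"
    "\<not> (length p \<le> length t + 2 \<and> length t + 3 < length p + length a)"
    "\<not> (length p \<le> length t + 4 \<and> length t + 5 < length p + length a)"
    using nb[of "length t"] nb[of "length t + 2"] nb[of "length t + 4"] unfolding e W by blast+
  then show False using N assms(2) by linarith
qed

text \<open>A run of length at least 3 that meets \<open>cc\<close> also covers a neighbouring
  \<open>y\<close> or \<open>x\<close>, which differs from \<open>c\<close>.\<close>

lemma squares_separate_power:
  assumes "m \<ge> 3" "y \<noteq> c" "x \<noteq> c" "t @ [y, y, c, c, x, x] @ t' = p @ replicate m z @ q"
  shows "length p + m \<le> length t + 2 \<or> length t + 4 \<le> length p"
proof (rule ccontr)
  let ?W = "t @ [y, y, c, c, x, x] @ t'"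
  assume N: "\<not> ?thesis"
  have W: "?W ! (length t + 1) = y" "?W ! (length t + 2) = c"
    "?W ! (length t + 3) = c" "?W ! (length t + 4) = x"
    by (simp_all add: nth_append)
  have nb: "?W ! i = z" if "length p \<le> i" "i < length p + m" for i
  proof -
    have "i - length p < m" using that by linarith
    then show ?thesis unfolding assms(4) using that by (simp add: nth_append)
  qed
  show False
  proof (cases "length p \<le> length t + 1")
    case True
    then show False using N nb[of "length t + 1"] nb[of "length t + 2"] W assms by auto
  next
    case False
    then show False using N nb[of "length t + 4"] nb[of "length t + 3"] W assms by auto
  qed
qed

text \<open>Consecutive relators must lie on the same side: the next one starts where the previous
  one ends, and the positions from \<open>i\<close> to \<open>j\<close> leave a gap that no single
  boundary can bridge.\<close>

lemma blocks_separate: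
  assumes sep: "\<And>p a q. a \<in> R \<Longrightarrow> w = p @ a @ q \<Longrightarrow> length (p @ a) \<le> i \<or> j \<le> length p"
    and "i < j" "ws \<noteq> []" "set ws \<subseteq> R" "w = p @ concat ws @ q"
  shows "length (p @ concat ws) \<le> i \<or> j \<le> length p"
  using assms(3-5)
proof (induction ws arbitrary: p rule: list_nonempty_induct)
  case (single a)
  then show ?case using sep[of a p q] by simp
next
  case (cons a ws)
  have "length (p @ a) \<le> i \<or> j \<le> length p" using cons.prems sep[of a p "concat ws @ q"] by simp
  moreover have "length ((p @ a) @ concat ws) \<le> i \<or> j \<le> length (p @ a)"
    using cons.prems by (intro cons.IH) simp_all
  ultimately show ?case using assms(2) by auto
qed

lemma wcong_lists:
  assumes "\<And>a. a \<in> R \<Longrightarrow> set a = A" "wcong R u v" "u \<in> lists A" shows "v \<in> lists A"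
  using assms(2,3)
proof induction
  case (step v w)
  then show ?case unfolding rstep_def using assms(1) by auto
qed

section \<open>Words that cannot be altered at their end\<close>

locale relators =
  fixes A :: "'a set" and n :: nat and R :: "'a list set"
  assumes n3: "n \<ge> 3" and cardA: "card A = n"
    and relD: "a \<in> R \<Longrightarrow> distinct a \<and> length a = n \<and> set a \<subseteq> A"
begin

lemma rel_ne: "a \<in> R \<Longrightarrow> a \<noteq> []" using relD n3 by force

lemma wcong_length: "wcong R u v \<Longrightarrow> length u = length v"
  by (induction rule: rtranclp_induct) (auto simp: rstep_def relD)

text \<open>Follow the rewriting until the final \<open>y\<close> is touched for the first time. At
  that moment a relator ending in \<open>y\<close> is a suffix, and what precedes \<open>y\<close>
  is still congruent to \<open>u\<close>.\<close>

lemma wcong_snoc: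
  assumes "wcong R (u @ [y]) w"
  shows "(\<exists>u'. wcong R u u' \<and> w = u' @ [y]) \<or> (\<exists>r. \<exists>a\<in>R. last a = y \<and> wcong R u (r @ butlast a))"
  using assms
proof induction
  case (step v w)
  from step.IH show ?case
  proof
    assume "\<exists>u'. wcong R u u' \<and> v = u' @ [y]"
    then obtain u' where u': "wcong R u u'" "v = u' @ [y]" by blast
    obtain p a b q where pq: "a \<in> R" "b \<in> R" "v = p @ a @ q" "w = p @ b @ q"
      using step.hyps unfolding rstep_def by blast
    show ?thesis
    proof (cases q rule: rev_cases)
      case Nil
      then have "u' = p @ butlast a" "last a = y"
        using u' pq rel_ne[OF pq(1)] append_eq_snoc[of p a u' y] by simp_all
      then show ?thesis using u' pq by blast
    next
      case (snoc q' y')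
      then have "u' = p @ a @ q'" "y' = y" using u' pq by simp_all
      moreover have "wcong R (p @ a @ q') (p @ b @ q')"
        by (intro wcong_context wcong_relators pq)
      ultimately show ?thesis using u'(1) pq(4) snoc by (metis append.assoc rtranclp_trans)
    qed
  qed blast
qed blast

text \<open>The first exchange that touches the final \<open>y\<close> gives a relator whose last
  letter is \<open>y\<close> itself, so the condition can be read off the shorter word
  \<open>u\<close>.\<close>

lemma ends_in_snoc:
  "ends_in R (u @ [y]) \<longleftrightarrow> (\<exists>r. \<exists>a\<in>R. last a = y \<and> wcong R u (r @ butlast a))"
proof
  assume "ends_in R (u @ [y])"
  then obtain r a where ra: "a \<in> R" "wcong R (u @ [y]) (r @ a)" unfolding ends_in_def by blast
  from wcong_snoc[OF ra(2)]
  consider u' where "wcong R u u'" "r @ a = u' @ [y]" | "\<exists>r. \<exists>a\<in>R. last a = y \<and> wcong R u (r @ butlast a)"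
    by blast
  then show "\<exists>r. \<exists>a\<in>R. last a = y \<and> wcong R u (r @ butlast a)"
  proof cases
    case 1
    then have "u' = r @ butlast a" "last a = y" using append_eq_snoc[of r a u' y] rel_ne[OF ra(1)] by simp_all
    then show ?thesis using 1 ra by blast
  qed
next
  assume "\<exists>r. \<exists>a\<in>R. last a = y \<and> wcong R u (r @ butlast a)"
  then obtain r a where ra: "a \<in> R" "last a = y" "wcong R u (r @ butlast a)" by blast
  then have "wcong R (u @ [y]) (r @ a)"
    using wcong_appendR[OF ra(3), of "[y]"] rel_ne[OF ra(1)] by (metis append.assoc append_butlast_last_id)
  then show "ends_in R (u @ [y])" using ra unfolding ends_in_def by blast
qed

lemma wcong_snoc_untouched:
  assumes "\<not> ends_in R (u @ [y])" "wcong R (u @ [y]) w"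
  obtains u' where "wcong R u u'" "w = u' @ [y]"
  using wcong_snoc[OF assms(2)] assms(1) unfolding ends_in_snoc by blast

lemma last_butlast_rel:
  assumes "a \<in> R"
  shows "butlast a \<noteq> []" "last (butlast a) = a ! (n - 2)" "last a = a ! (n - 1)"
    "last (butlast a) \<noteq> last a" "last a \<in> A" "last (butlast a) \<in> A"
proof -
  have l: "length a = n" "distinct a" "set a \<subseteq> A" using relD[OF assms] by auto
  show b: "butlast a \<noteq> []" using l n3 by (auto simp: length_butlast simp flip: length_greater_0_conv)
  show 1: "last (butlast a) = a ! (n - 2)" using b l n3
    by (simp add: last_conv_nth nth_butlast numeral_2_eq_2)
  show 2: "last a = a ! (n - 1)" using l rel_ne[OF assms] by (simp add: last_conv_nth)
  show "last (butlast a) \<noteq> last a" unfolding 1 2 using l n3 by (simp add: nth_eq_iff_index_eq)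
  show "last a \<in> A" "last (butlast a) \<in> A" unfolding 1 2 using l n3 by (auto intro!: subsetD[OF l(3)])
qed

text \<open>Since the final letter is fixed, a new forbidden factor must be a suffix. A power of a
  letter would leave \<open>yy\<close> at the end of a representative of \<open>u\<close>, and a
  product of relators would contradict \<open>E\<close>.\<close>

lemma not_hits_snoc:
  assumes adm: "admissible R F" and E: "\<not> ends_in R (u @ [y])" and h: "\<not> hits R F u"
    and yy: "\<And>t. \<not> wcong R u (t @ [y, y])"
  shows "\<not> hits R F (u @ [y])"
proof
  assume "hits R F (u @ [y])"
  then obtain f c e where f: "f \<in> F" "wcong R (u @ [y]) (c @ f @ e)" unfolding hits_def by blast
  obtain u' where u': "wcong R u u'" "c @ f @ e = u' @ [y]" using wcong_snoc_untouched[OF E f(2)] .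
  show False
  proof (cases e rule: rev_cases)
    case (snoc e' y')
    then have "u' = c @ f @ e'" using u' by simp
    then show False using h u' f unfolding hits_def by blast
  next
    case Nil
    consider m x where "m \<ge> 3" "f = replicate m x" | ws where "ws \<noteq> []" "set ws \<subseteq> R" "f = concat ws"
      using adm f(1) unfolding admissible_def by blast
    then show False
    proof cases
      case 1
      have "m = Suc (Suc (Suc (m - 3)))" using 1 by simp
      then obtain k where "m = Suc (Suc (Suc k))" by blast
      then have "f = replicate k x @ [x, x, x]"
        using 1 replicate_add[of k 3 x] by (simp add: numeral_3_eq_3)
      then have "(c @ replicate k x @ [x, x]) @ [x] = u' @ [y]" using u' Nil by auto
      then have "u' = c @ replicate k x @ [x, x]" "x = y" unfolding append1_eq_conv by blast+
      then have "u' = (c @ replicate k y) @ [y, y]" by simp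
      then show False using yy u' by blast
    next
      case 2
      then obtain ws' a where "ws = ws' @ [a]" by (metis rev_exhaust)
      then have "a \<in> R" "c @ f @ e = (c @ concat ws') @ a" using 2 Nil by auto
      then show False using f(2) E unfolding ends_in_def by metis
    qed
  qed
qed

text \<open>The first \<open>y\<close> is fixed by \<open>E\<close>. The second is fixed too, since
  a relator ending there would have two equal last letters. As no representative of \<open>u\<close>
  ends in \<open>y\<close>, the square does not grow into a cube.\<close>

lemma extend_square:
  assumes adm: "admissible R F" and h: "\<not> hits R F u"
    and ny: "\<And>t. \<not> wcong R u (t @ [y])" and E: "\<not> ends_in R (u @ [y])"
  shows "\<not> hits R F (u @ [y, y])" "wcong R (u @ [y, y]) w \<Longrightarrow> \<exists>t. w = t @ [y, y]"
proof -
  have E2: "\<not> ends_in R ((u @ [y]) @ [y])"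
  proof
    assume "ends_in R ((u @ [y]) @ [y])"
    then obtain r a where ra: "a \<in> R" "last a = y" "wcong R (u @ [y]) (r @ butlast a)"
      unfolding ends_in_snoc by blast
    from wcong_snoc_untouched[OF E ra(3)] obtain u' where "r @ butlast a = u' @ [y]" .
    then have "last (butlast a) = y" using last_butlast_rel(1)[OF ra(1)] by (metis last_appendR last_snoc)
    then show False using last_butlast_rel(4)[OF ra(1)] ra by simp
  qed
  have "\<not> hits R F (u @ [y])"
    by (rule not_hits_snoc[OF adm E h]) (use ny[of "_ @ [y]"] in simp)
  then have "\<not> hits R F ((u @ [y]) @ [y])"
  proof (rule not_hits_snoc[OF adm E2])
    fix t show "\<not> wcong R (u @ [y]) (t @ [y, y])"
    proof
      assume "wcong R (u @ [y]) (t @ [y, y])"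
      from wcong_snoc_untouched[OF E this] obtain u' where "wcong R u u'" "t @ [y, y] = u' @ [y]" .
      then show False using ny[of t] by simp
    qed
  qed
  then show "\<not> hits R F (u @ [y, y])" by simp
  assume "wcong R (u @ [y, y]) w"
  then have "wcong R ((u @ [y]) @ [y]) w" by simp
  from wcong_snoc_untouched[OF E2 this] obtain v where v: "wcong R (u @ [y]) v" "w = v @ [y]" .
  from wcong_snoc_untouched[OF E v(1)] obtain t where "v = t @ [y]" .
  then show "\<exists>t. w = t @ [y, y]" using v by simp
qed

lemma pick_letter: "\<exists>c\<in>A. c \<noteq> x \<and> c \<noteq> y"
proof (rule ccontr)
  assume "\<not> ?thesis"
  then have "A \<subseteq> {x, y}" by blast
  then have "card A \<le> card {x, y}" by (rule card_mono[rotated]) simp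
  also have "\<dots> \<le> 2" by (simp add: card_insert_if)
  finally show False using n3 cardA by simp
qed

text \<open>An appended \<open>x\<close> can never be altered, so the only danger in appending
  \<open>xx\<close> is a cube. If a representative of \<open>u\<close> already ends in
  \<open>x\<close>, its run of \<open>x\<close> is completed to a square if necessary, and
  \<open>yy\<close> is put behind it.\<close>

lemma extendable_nonlast:
  assumes xA: "x \<in> A" and nl: "\<And>a. a \<in> R \<Longrightarrow> last a \<noteq> x"
  shows "extendable A R"
  unfolding extendable_def
proof (intro allI impI, elim conjE)
  fix F u assume adm: "admissible R F" and u: "u \<in> lists A" and h: "\<not> hits R F u"
  let ?G = "\<lambda>u. \<exists>p\<in>lists A. \<not> hits R F (u @ p) \<and> (\<exists>y\<in>A. \<forall>w. wcong R (u @ p) w \<longrightarrow> (\<exists>t. w = t @ [y, y]))"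
  have Ex: "\<not> ends_in R (v @ [x])" for v using nl unfolding ends_in_snoc by blast
  obtain y where y: "y \<in> A" "y \<noteq> x" using pick_letter by blast
  \<comment> \<open>The square \<open>xx\<close> is fixed, so a relator ending at the first
    \<open>y\<close> after it would contain both copies of \<open>x\<close>; here it matters that a
    relator has at least two letters before its last.\<close>
  have sq: "\<not> hits R F (t @ [x, x, y, y]) \<and> (\<forall>w. wcong R (t @ [x, x, y, y]) w \<longrightarrow> (\<exists>t. w = t @ [y, y]))"
    if "\<not> hits R F (t @ [x, x])" for t
  proof -
    have rep: "\<exists>s. w = s @ [x, x]" if "wcong R (t @ [x, x]) w" for w
    proof -
      have "wcong R ((t @ [x]) @ [x]) w" using that by simp
      from wcong_snoc_untouched[OF Ex this] obtain v where v: "wcong R (t @ [x]) v" "w = v @ [x]" .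
      from wcong_snoc_untouched[OF Ex v(1)] obtain s where "v = s @ [x]" .
      then show ?thesis using v by simp
    qed
    have "\<not> wcong R (t @ [x, x]) (s @ [y])" for s using rep[of "s @ [y]"] y by auto
    moreover have "\<not> ends_in R ((t @ [x, x]) @ [y])"
    proof
      assume "ends_in R ((t @ [x, x]) @ [y])"
      then obtain r a where ra: "a \<in> R" "wcong R (t @ [x, x]) (r @ butlast a)"
        unfolding ends_in_snoc by blast
      obtain s where s: "r @ butlast a = s @ [x, x]" using rep[OF ra(2)] by blast
      have d: "length (butlast a) \<ge> 2" "distinct (butlast a)" using relD[OF ra(1)] n3
        by (auto simp: distinct_butlast)
      then have "rev (take 2 (rev (r @ butlast a))) = drop (length (butlast a) - 2) (butlast a)"
        by (simp add: take_rev)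
      then have "drop (length (butlast a) - 2) (butlast a) = [x, x]" unfolding s by simp
      then show False using d by (metis distinct_drop distinct_length_2_or_more)
    qed
    ultimately show ?thesis using extend_square[OF adm that, of y] by auto
  qed
  show "?G u"
  proof (cases "\<exists>t. wcong R u (t @ [x])")
    case False
    then have "\<not> hits R F (u @ [x, x]) \<and> (\<forall>w. wcong R (u @ [x, x]) w \<longrightarrow> (\<exists>t. w = t @ [x, x]))"
      using extend_square[OF adm h _ Ex] by blast
    then show ?thesis using xA by (intro bexI[of _ "[x, x]"]) auto
  next
    case True
    then obtain t where t: "wcong R u (t @ [x])" by blast
    show ?thesis
    proof (cases "\<exists>s. wcong R t (s @ [x])")
      case True
      then obtain s where "wcong R t (s @ [x])" by blast
      then have us: "wcong R u (s @ [x, x])" using wcong_appendR[of R t "s @ [x]" "[x]"] t by auto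
      then have "\<not> hits R F (s @ [x, x])" using h hits_cong by blast
      note * = sq[OF this]
      have c: "wcong R (u @ [y, y]) (s @ [x, x, y, y])" using wcong_appendR[OF us, of "[y, y]"] by simp
      have "\<not> hits R F (u @ [y, y]) \<and> (\<forall>w. wcong R (u @ [y, y]) w \<longrightarrow> (\<exists>t. w = t @ [y, y]))"
        using * hits_cong[OF c] wcong_sym[OF c] by (meson rtranclp_trans)
      then show ?thesis using y by (intro bexI[of _ "[y, y]"]) auto
    next
      case False
      \<comment> \<open>Only one \<open>x\<close> can stand at the end here, so one more
        \<open>x\<close> gives a square and no cube.\<close>
      have "\<not> hits R F (t @ [x])" using h hits_cong[OF t] by blast
      then have "\<not> hits R F ((t @ [x]) @ [x])"
      proof (rule not_hits_snoc[OF adm Ex])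
        fix s show "\<not> wcong R (t @ [x]) (s @ [x, x])"
        proof
          assume "wcong R (t @ [x]) (s @ [x, x])"
          from wcong_snoc_untouched[OF Ex this] obtain t' where "wcong R t t'" "s @ [x, x] = t' @ [x]" .
          then show False using False by auto
        qed
      qed
      then have "\<not> hits R F (t @ [x, x])" by simp
      note * = sq[OF this]
      have c: "wcong R (u @ [x, y, y]) (t @ [x, x, y, y])" using wcong_appendR[OF t, of "[x, y, y]"] by simp
      have "\<not> hits R F (u @ [x, y, y]) \<and> (\<forall>w. wcong R (u @ [x, y, y]) w \<longrightarrow> (\<exists>t. w = t @ [y, y]))"
        using * hits_cong[OF c] wcong_sym[OF c] by (meson rtranclp_trans)
      then show ?thesis using y xA by (intro bexI[of _ "[x, y, y]"]) auto
    qed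
  qed
qed

end

section \<open>Regular relators\<close>

text \<open>\<open>D i\<close> maps the letter of a relator at position \<open>i\<close> (counted from 0) to the next letter.\<close>

locale regular_relators = relators +
  fixes D :: "nat \<Rightarrow> 'a \<Rightarrow> 'a"
  assumes last_inj: "a \<in> R \<Longrightarrow> b \<in> R \<Longrightarrow> last a = last b \<Longrightarrow> a = b"
    and last_ex: "x \<in> A \<Longrightarrow> \<exists>a\<in>R. last a = x"
    and D_step: "a \<in> R \<Longrightarrow> Suc i < n \<Longrightarrow> a ! Suc i = D i (a ! i)"
    and D_eq: "Suc i < n \<Longrightarrow> Suc j < n \<Longrightarrow> x \<in> A \<Longrightarrow> D i x = D j x \<Longrightarrow> D i = D j"
    and D_inj: "Suc i < n \<Longrightarrow> inj_on (D i) A"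
    and D_nonconst: "\<exists>i. Suc i < n \<and> D i \<noteq> D (n - 2)"
begin

text \<open>Either the last letter is never touched, or all exchanges at the end can be merged into
  a single one over a common prefix \<open>r\<close>. Merging needs cancellation for shorter words,
  assumed here because \<open>cancel_letter\<close> supplies it by induction on the length.\<close>

lemma snoc_dichotomy_aux:
  assumes cancel: "\<forall>v v' y. length v < length w \<longrightarrow> wcong R (v @ [y]) (v' @ [y]) \<longrightarrow> wcong R v v'"
    and c: "wcong R (w @ [x]) u"
  shows "\<exists>w' x'. u = w' @ [x'] \<and> (x = x' \<and> wcong R w w' \<or>
    (\<exists>r. \<exists>a\<in>R. \<exists>a'\<in>R. last a = x \<and> last a' = x' \<and> wcong R w (r @ butlast a) \<and> wcong R w' (r @ butlast a')))"
  using c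
proof induction
  case base
  show ?case by blast
next
  case (step v u)
  have cancels: "wcong R r p" if "wcong R (r @ s) (p @ s)" "length (r @ s) \<le> length w" for r p s
    using that
  proof (induction s rule: rev_induct)
    case (snoc y s)
    then show ?case using cancel[rule_format, of "r @ s" y "p @ s"] by simp
  qed simp
  obtain w1 x1 where v: "v = w1 @ [x1]" and alt: "x = x1 \<and> wcong R w w1 \<or>
    (\<exists>r. \<exists>a\<in>R. \<exists>a'\<in>R. last a = x \<and> last a' = x1 \<and> wcong R w (r @ butlast a) \<and> wcong R w1 (r @ butlast a'))"
    using step.IH by blast
  have len: "length w1 = length w" using wcong_length[OF step.hyps(1)] v by simp
  obtain p a b q where pq: "a \<in> R" "b \<in> R" "v = p @ a @ q" "u = p @ b @ q"
    using step.hyps(2) unfolding rstep_def by blast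
  show ?case
  proof (cases q rule: rev_cases)
    case Nil
    have w1: "w1 = p @ butlast a" "last a = x1"
      using v pq rel_ne[OF pq(1)] Nil append_eq_snoc[of p a w1 x1] by simp_all
    have u: "u = (p @ butlast b) @ [last b]" using pq Nil rel_ne[OF pq(2)] by simp
    have "\<exists>a\<in>R. last a = x \<and> wcong R w (p @ butlast a)"
      using alt
    proof
      assume "x = x1 \<and> wcong R w w1"
      then show ?thesis using w1 pq by blast
    next
      assume "\<exists>r. \<exists>a\<in>R. \<exists>a'\<in>R. last a = x \<and> last a' = x1 \<and> wcong R w (r @ butlast a) \<and> wcong R w1 (r @ butlast a')"
      then obtain r c c' where c: "c \<in> R" "c' \<in> R" "last c = x" "last c' = x1"
        "wcong R w (r @ butlast c)" "wcong R w1 (r @ butlast c')" by blast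
      \<comment> \<open>The earlier exchange left a relator with the same last letter as
        \<open>a\<close>, hence \<open>a\<close> itself. Cancelling \<open>butlast a\<close>
        identifies the old prefix \<open>r\<close> with the new prefix \<open>p\<close>.\<close>
      have "c' = a" using last_inj c w1 pq by blast
      then have "wcong R (r @ butlast a) (p @ butlast a)" using c w1 wcong_sym by metis
      moreover have "length (r @ butlast a) \<le> length w"
        using wcong_length[OF c(6)] len \<open>c' = a\<close> by simp
      ultimately have "wcong R r p" by (rule cancels)
      then have "wcong R w (p @ butlast c)" using c(5) wcong_appendR by (meson rtranclp_trans)
      then show ?thesis using c by blast
    qed
    then show ?thesis using u pq by blast
  next
    case (snoc q' y)
    then have w1: "w1 = p @ a @ q'" "x1 = y" using v pq by simp_all
    have u: "u = (p @ b @ q') @ [x1]" using pq snoc w1 by simp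
    have "wcong R w1 (p @ b @ q')" unfolding w1 by (intro wcong_context wcong_relators pq)
    then have "wcong R w1 z \<Longrightarrow> wcong R (p @ b @ q') z" "wcong R z w1 \<Longrightarrow> wcong R z (p @ b @ q')" for z
      by (meson wcong_sym rtranclp_trans)+
    then show ?thesis using alt u by (intro exI[of _ "p @ b @ q'"] exI[of _ x1]) blast
  qed
qed

text \<open>If the common last letter was touched, the two relators in the dichotomy have the same
  last letter, so they coincide and both prefixes are congruent to the same word.\<close>

lemma cancel_letter: "wcong R (w @ [x]) (w' @ [x]) \<Longrightarrow> wcong R w w'"
proof (induction "length w" arbitrary: w w' x rule: less_induct)
  case less
  have "\<forall>v v' y. length v < length w \<longrightarrow> wcong R (v @ [y]) (v' @ [y]) \<longrightarrow> wcong R v v'"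
    using less.hyps by blast
  from snoc_dichotomy_aux[OF this less.prems]
  consider "wcong R w w'" | r a a' where "a \<in> R" "a' \<in> R" "last a = x" "last a' = x"
    "wcong R w (r @ butlast a)" "wcong R w' (r @ butlast a')" by auto
  then show ?case
  proof cases
    case 2
    then have "a = a'" using last_inj by blast
    then show ?thesis using 2 by (meson wcong_sym rtranclp_trans)
  qed
qed

lemma snoc_dichotomy:
  assumes "wcong R (w @ [x]) (w' @ [x'])"
  obtains "x = x'" "wcong R w w'"
  | r a a' where "a \<in> R" "a' \<in> R" "last a = x" "last a' = x'"
      "wcong R w (r @ butlast a)" "wcong R w' (r @ butlast a')"
proof -
  have "\<forall>v v' y. length v < length w \<longrightarrow> wcong R (v @ [y]) (v' @ [y]) \<longrightarrow> wcong R v v'"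
    using cancel_letter by blast
  from snoc_dichotomy_aux[OF this assms] show thesis using that by auto
qed

lemma snoc_dichotomy_ends:
  assumes "wcong R (w @ [x]) (w' @ [x'])" "\<not> ends_in R (w @ [x])"
  shows "x = x'" "wcong R w w'"
  using snoc_dichotomy[OF assms(1)] assms(2) ends_in_snoc by metis+

text \<open>Otherwise \<open>w\<close> has a representative ending in a relator and another ending
  in \<open>butlast b\<close>. The former relator may be replaced by the relator \<open>a\<close>
  whose last letter is that of \<open>butlast b\<close>, so the two endings agree in their last
  letter but with positions shifted by one. Tracing the agreement to the left makes all
  \<open>D i\<close> equal, against \<open>D_nonconst\<close>.\<close>

lemma no_consecutive_ends: "ends_in R w \<Longrightarrow> \<not> ends_in R (w @ [x])"
proof (induction "length w" arbitrary: w x rule: less_induct)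
  case less
  show ?case
  proof
    assume "ends_in R (w @ [x])"
    then obtain v b where b: "b \<in> R" "wcong R w (v @ butlast b)" unfolding ends_in_snoc by blast
    obtain r c where c: "c \<in> R" "wcong R w (r @ c)" using less.prems unfolding ends_in_def by blast
    obtain a where a: "a \<in> R" "last a = last (butlast b)" using last_ex last_butlast_rel(6)[OF b(1)] by blast
    have la: "length a = n" "set a \<subseteq> A" and lb: "length b = n" "set b \<subseteq> A"
      using relD a b by auto
    have wra: "wcong R w (r @ a)" using c wcong_appendL[OF wcong_relators[OF c(1) a(1)], of r]
      by (meson rtranclp_trans)
    have lw: "length w = length r + n" using wcong_length[OF wra] la by simp
    txt \<open>Strip the last letters of both sides one by one. Should they ever differ, then
      \<open>r @ take (j + 2) a\<close> would end in a relator, and by induction on the length its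
      prefix would not; comparing last letters then yields \<open>D j = D (n - 2)\<close> after all.\<close>
    have inv: "wcong R (r @ take (n - k) a) (v @ take (n - k - 1) b) \<and> a ! (n - k - 1) = b ! (n - k - 2)
        \<and> (\<forall>i. n - k - 2 \<le> i \<and> Suc i < n \<longrightarrow> D i = D (n - 2))" if "k \<le> n - 2" for k
      using that
    proof (induction k)
      case 0
      have "take (n - 1) b = butlast b" using lb by (simp add: butlast_conv_take)
      moreover have "wcong R (r @ a) (v @ butlast b)" using wra b wcong_sym by (meson rtranclp_trans)
      moreover have "a ! (n - 1) = b ! (n - 2)"
        using a last_butlast_rel(2)[OF b(1)] last_butlast_rel(3)[OF a(1)] by simp
      moreover have "i = n - 2" if "n - 2 \<le> i" "Suc i < n" for i using that by linarith
      ultimately show ?case using la by auto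
    next
      case (Suc k)
      define j where "j = n - k - 3"
      have j: "n - k = j + 3" "n - Suc k = j + 2" "n - Suc k - 1 = j + 1" "n - Suc k - 2 = j" "j + 3 \<le> n"
        "n - k - 1 = j + 2" "n - k - 2 = j + 1"
        using Suc.prems unfolding j_def by linarith+
      have IH: "wcong R (r @ take (j + 3) a) (v @ take (j + 2) b)" "a ! (j + 2) = b ! (j + 1)"
        "\<And>i. j + 1 \<le> i \<Longrightarrow> Suc i < n \<Longrightarrow> D i = D (n - 2)"
        using Suc.IH Suc.prems unfolding j by auto
      have tk: "take (Suc i) l = take i l @ [l ! i]" if "length l = n" "i < n" for l :: "'a list" and i
        using that by (simp add: take_Suc_conv_app_nth)
      have mem: "a ! i \<in> A" "b ! i \<in> A" if "i < n" for i using la lb that by auto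
      have "wcong R (r @ take (j + 2) a) (v @ take (j + 1) b)"
      proof (rule cancel_letter)
        show "wcong R ((r @ take (j + 2) a) @ [a ! (j + 2)]) ((v @ take (j + 1) b) @ [a ! (j + 2)])"
          using IH(1,2) tk[of a "j + 2"] tk[of b "j + 1"] la lb j by (simp add: numeral_3_eq_3)
      qed
      note c1 = this
      have Da: "a ! (j + 2) = D (j + 1) (a ! (j + 1))" using D_step[OF a(1), of "j + 1"] j by simp
      have Db: "b ! (j + 1) = D j (b ! j)" using D_step[OF b(1), of j] j by simp
      have DD: "D (j + 1) = D (n - 2)" using IH(3)[of "j + 1"] j by simp
      have "D j = D (j + 1)"
      proof (cases "a ! (j + 1) = b ! j")
        case True
        \<comment> \<open>The equal letters \<open>b ! (j + 1)\<close> and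
          \<open>a ! (j + 2)\<close> are then images of one letter under \<open>D j\<close> and
          \<open>D (j + 1)\<close>.\<close>
        then have "D j (b ! j) = D (j + 1) (b ! j)" using Da Db IH(2) by simp
        then show ?thesis using D_eq[of j "j + 1"] mem[of j] j by simp
      next
        case False
        have "wcong R ((r @ take (j + 1) a) @ [a ! (j + 1)]) ((v @ take j b) @ [b ! j])"
          using c1 tk[of a "j + 1"] tk[of b j] la lb j by simp
        from snoc_dichotomy[OF this] False
        obtain x' d where d: "d \<in> R" "last d = a ! (j + 1)" "wcong R (r @ take (j + 1) a) (x' @ butlast d)"
          by metis
        then have "ends_in R ((r @ take (j + 1) a) @ [a ! (j + 1)])" using ends_in_snoc by blast
        moreover have "length (r @ take (j + 1) a) < length w" using lw la j by simp
        ultimately have nE: "\<not> ends_in R (r @ take (j + 1) a)" using less.hyps by blast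
        have e1: "r @ take (j + 1) a = (r @ take j a) @ [a ! j]" using tk[of a j] la j by simp
        have e2: "x' @ butlast d = (x' @ butlast (butlast d)) @ [d ! (n - 2)]"
          using last_butlast_rel(1,2)[OF d(1)] by (metis append.assoc append_butlast_last_id)
        have "a ! j = d ! (n - 2)" using snoc_dichotomy_ends(1) d(3) nE unfolding e1 e2 by blast
        moreover have "a ! (j + 1) = D j (a ! j)" using D_step[OF a(1), of j] j by simp
        moreover have "a ! (j + 1) = D (n - 2) (d ! (n - 2))"
          using d(2) last_butlast_rel(3)[OF d(1)] D_step[OF d(1), of "n - 2"] n3
          by (simp add: Suc_diff_Suc numeral_2_eq_2)
        ultimately have "D j (a ! j) = D (n - 2) (a ! j)" by simp
        then show ?thesis using D_eq[of j "n - 2"] mem[of j] j DD by simp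
      qed
      note Dj = this
      have "a ! (j + 1) = b ! j"
      proof (rule inj_onD[OF D_inj[of j]])
        show "D j (a ! (j + 1)) = D j (b ! j)" using Da Db IH(2) Dj by simp
      qed (use mem j in auto)
      moreover have "D i = D (n - 2)" if "j \<le> i" "Suc i < n" for i
        using that IH(3)[of i] Dj DD by (cases "i = j") auto
      ultimately show ?case using c1 unfolding j by simp
    qed
    \<comment> \<open>For \<open>k = n - 2\<close> the range of indices in the invariant starts at 0
      and so covers every \<open>D i\<close>.\<close>
    have "n - (n - 2) - 2 = 0" using n3 by linarith
    then have "D i = D (n - 2)" if "Suc i < n" for i using inv[of "n - 2"] that by (metis le0 order_refl)
    then show False using D_nonconst by blast
  qed
qed

text \<open>If \<open>u\<close> is not in Sz, its last letter is fixed and a suitable square can be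
  appended at once. If it is, one arbitrary letter leads out of Sz by
  \<open>no_consecutive_ends\<close>, and the square follows.\<close>

lemma extendable_regular: "extendable A R"
  unfolding extendable_def
proof (intro allI impI, elim conjE)
  fix F u assume adm: "admissible R F" and u: "u \<in> lists A" and h: "\<not> hits R F u"
  have ext: "\<exists>y\<in>A. \<not> hits R F (v @ [y, y]) \<and> (\<forall>w. wcong R (v @ [y, y]) w \<longrightarrow> (\<exists>t. w = t @ [y, y]))"
    if E: "\<not> ends_in R v" and h: "\<not> hits R F v" for v
  proof -
    have "\<exists>y\<in>A. (\<forall>t. \<not> wcong R v (t @ [y])) \<and> \<not> ends_in R (v @ [y])"
    proof (cases v rule: rev_cases)
      case Nil
      obtain y where y: "y \<in> A" using pick_letter by blast
      have "\<not> ends_in R ([] @ [y])"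
        using last_butlast_rel(1) wcong_length[of "[]"] unfolding ends_in_snoc by auto
      moreover have "\<not> wcong R [] (t @ [y])" for t using wcong_length[of "[]" "t @ [y]"] by auto
      ultimately show ?thesis using Nil y by blast
    next
      case (snoc t l)
      \<comment> \<open>Avoiding \<open>l\<close> keeps \<open>y\<close> from extending a run;
        avoiding \<open>D (n - 2) l\<close> keeps \<open>l\<close> and \<open>y\<close> from being
        the last two letters of a relator. Three letters suffice for this choice.\<close>
      obtain y where y: "y \<in> A" "y \<noteq> l" "y \<noteq> D (n - 2) l" using pick_letter by blast
      have "\<not> wcong R v (s @ [y])" for s
        using snoc_dichotomy_ends(1)[of t l s y] E y snoc by blast
      moreover have "\<not> ends_in R (v @ [y])"
      proof
        assume "ends_in R (v @ [y])"
        then obtain r a where a: "a \<in> R" "last a = y" "wcong R v (r @ butlast a)"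
          unfolding ends_in_snoc by blast
        have "r @ butlast a = (r @ butlast (butlast a)) @ [a ! (n - 2)]"
          using last_butlast_rel(1,2)[OF a(1)] by (metis append.assoc append_butlast_last_id)
        then have "l = a ! (n - 2)" using snoc_dichotomy_ends(1) E a snoc by metis
        then have "y = D (n - 2) l"
          using a(2) last_butlast_rel(3)[OF a(1)] D_step[OF a(1), of "n - 2"] n3
          by (simp add: Suc_diff_Suc numeral_2_eq_2)
        then show False using y by simp
      qed
      ultimately show ?thesis using y by blast
    qed
    then show ?thesis using extend_square[OF adm h] by blast
  qed
  show "\<exists>p\<in>lists A. \<not> hits R F (u @ p) \<and> (\<exists>y\<in>A. \<forall>w. wcong R (u @ p) w \<longrightarrow> (\<exists>t. w = t @ [y, y]))"
  proof (cases "ends_in R u")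
    case False
    from ext[OF this h] obtain y where "y \<in> A" "\<not> hits R F (u @ [y, y])"
      "\<forall>w. wcong R (u @ [y, y]) w \<longrightarrow> (\<exists>t. w = t @ [y, y])" by blast
    then show ?thesis by (intro bexI[of _ "[y, y]"]) auto
  next
    case True
    obtain x where x: "x \<in> A" using pick_letter by blast
    have E: "\<not> ends_in R (u @ [x])" using no_consecutive_ends[OF True] .
    \<comment> \<open>Write \<open>u\<close> with the relator ending in \<open>x\<close> as its
      suffix and cancel that \<open>x\<close>. The remaining word is not in Sz, because appending
      \<open>x\<close> gives an element of Sz, so its last letter is fixed and would be
      \<open>x\<close> as well.\<close>
    have "\<not> wcong R u (t @ [x, x])" for t
    proof
      assume t: "wcong R u (t @ [x, x])"
      obtain r c where c: "c \<in> R" "wcong R u (r @ c)" using True unfolding ends_in_def by blast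
      obtain a where a: "a \<in> R" "last a = x" using last_ex x by blast
      have ra: "r @ a = ((r @ butlast (butlast a)) @ [last (butlast a)]) @ [x]"
        using a last_butlast_rel(1)[OF a(1)] rel_ne[OF a(1)] by (metis append.assoc append_butlast_last_id)
      have "wcong R (r @ a) ((t @ [x]) @ [x])"
        using c t wcong_appendL[OF wcong_relators[OF a(1) c(1)], of r]
        by simp (meson wcong_sym rtranclp_trans)
      then have s: "wcong R ((r @ butlast (butlast a)) @ [last (butlast a)]) (t @ [x])"
        unfolding ra by (rule cancel_letter)
      have "ends_in R (((r @ butlast (butlast a)) @ [last (butlast a)]) @ [x])"
        unfolding ra[symmetric] ends_in_def using a by blast
      then have "\<not> ends_in R ((r @ butlast (butlast a)) @ [last (butlast a)])"
        using no_consecutive_ends by blast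
      then have "last (butlast a) = x" using snoc_dichotomy_ends(1)[OF s] by blast
      then show False using last_butlast_rel(4)[OF a(1)] a by simp
    qed
    then have "\<not> hits R F (u @ [x])" using not_hits_snoc[OF adm E h] by blast
    from ext[OF E this] obtain y where "y \<in> A" "\<not> hits R F (u @ [x, y, y])"
      "\<forall>w. wcong R (u @ [x, y, y]) w \<longrightarrow> (\<exists>t. w = t @ [y, y])" by auto
    then show ?thesis using x by (intro bexI[of _ "[x, y, y]"]) auto
  qed
qed

end

section \<open>Primeness\<close>

context relators
begin

lemma separating_word:
  assumes ext: "extendable A R" "extendable A (rev ` R)" and adm: "admissible R F"
    and u: "u \<in> lists A" "\<not> hits R F u" and v: "v \<in> lists A" "\<not> hits R F v"
  shows "\<exists>s\<in>lists A. \<not> hits R F (u @ s @ v)"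
proof -
  obtain p y where p: "p \<in> lists A" "\<not> hits R F (u @ p)" "y \<in> A"
    "\<And>w. wcong R (u @ p) w \<Longrightarrow> \<exists>t. w = t @ [y, y]"
    using ext(1) adm u unfolding extendable_def by blast
  \<comment> \<open>Extending \<open>v\<close> to the left is extending its reversal to the
    right.\<close>
  have "rev v \<in> lists A" "\<not> hits (rev ` R) (rev ` F) (rev v)" using v by (auto simp: hits_rev_iff)
  then obtain q x where q: "q \<in> lists A" "\<not> hits (rev ` R) (rev ` F) (rev v @ q)" "x \<in> A"
    "\<And>w. wcong (rev ` R) (rev v @ q) w \<Longrightarrow> \<exists>t. w = t @ [x, x]"
    using ext(2) admissible_rev[OF adm] unfolding extendable_def by blast
  define U V where "U = u @ p" and "V = rev q @ v"
  have V: "\<not> hits R F V" using q(2) hits_rev_iff[of R F V] unfolding V_def by simp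
  have Vx: "\<exists>t. w = [x, x] @ t" if "wcong R V w" for w
  proof -
    have "wcong (rev ` R) (rev v @ q) (rev w)" using wcong_rev[OF that] unfolding V_def by simp
    then obtain t where "rev w = t @ [x, x]" using q(4) by blast
    then have "w = [x, x] @ rev t" by (simp add: rev_swap)
    then show ?thesis by blast
  qed
  \<comment> \<open>Being different from both \<open>x\<close> and \<open>y\<close>, this letter
    also stops powers from reaching across the middle.\<close>
  obtain c where c: "c \<in> A" "c \<noteq> x" "c \<noteq> y" using pick_letter by blast
  have shape: "\<exists>t t'. U' = t @ [y, y] \<and> U' @ [c, c] @ V' = t @ [y, y, c, c, x, x] @ t'"
    if "wcong R U U'" "wcong R V V'" for U' V'
    using p(4)[of U'] Vx[of V'] that unfolding U_def by auto
  have sep: "length (p @ a) \<le> length U' \<or> length (U' @ [c, c]) \<le> length p"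
    if UV: "wcong R U U'" "wcong R V V'" and a: "a \<in> R" and eq: "U' @ [c, c] @ V' = p @ a @ q"
    for U' V' p a q
  proof -
    obtain t t' where t: "U' = t @ [y, y]" "U' @ [c, c] @ V' = t @ [y, y, c, c, x, x] @ t'"
      using shape[OF UV] by blast
    then show ?thesis using squares_separate_distinct[of a t y c x t' p q] relD[OF a] n3 eq by force
  qed
  have "\<not> hits R F (U @ [c, c] @ V)"
  proof
    assume "hits R F (U @ [c, c] @ V)"
    then obtain f l r where f: "f \<in> F" "wcong R (U @ [c, c] @ V) (l @ f @ r)" unfolding hits_def by blast
    obtain U' V' where UV: "wcong R U U'" "wcong R V V'" "l @ f @ r = U' @ [c, c] @ V'"
    proof -
      have "\<exists>U' V'. wcong R U U' \<and> wcong R V V' \<and> l @ f @ r = U' @ [c, c] @ V'"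
        using sep f(2) by (rule wcong_sandwich)
      then show ?thesis using that by blast
    qed
    have "length (l @ f) \<le> length U' \<or> length (U' @ [c, c]) \<le> length l"
    proof -
      consider m z where "m \<ge> 3" "f = replicate m z" | ws where "ws \<noteq> []" "set ws \<subseteq> R" "f = concat ws"
        using adm f(1) unfolding admissible_def by blast
      then show ?thesis
      proof cases
        case 1
        obtain t t' where "U' = t @ [y, y]" "U' @ [c, c] @ V' = t @ [y, y, c, c, x, x] @ t'"
          using shape[OF UV(1,2)] by blast
        then show ?thesis using squares_separate_power[of m y c x t t' l z r] 1 c UV(3) by force
      next
        case 2
        show ?thesis unfolding 2(3)
        proof (rule blocks_separate[OF _ _ 2(1,2)])
          show "U' @ [c, c] @ V' = l @ concat ws @ r" using UV(3) 2(3) by simp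
        qed (use sep[OF UV(1,2)] in auto)
      qed
    qed
    then show False
    proof
      assume "length (l @ f) \<le> length U'"
      then obtain t where "U' = l @ f @ t"
        using append_split[of U' "[c, c] @ V'" "l @ f" r] UV(3) by auto
      then show False using p(2) UV(1) f(1) unfolding U_def hits_def by blast
    next
      assume "length (U' @ [c, c]) \<le> length l"
      then obtain t where "V' = t @ f @ r"
        using append_split[of l "f @ r" "U' @ [c, c]" V'] UV(3) by auto
      then show False using V UV(2) f(1) unfolding hits_def by blast
    qed
  qed
  moreover have "p @ [c, c] @ rev q \<in> lists A" using p q c by auto
  ultimately show ?thesis unfolding U_def V_def by (intro bexI[of _ "p @ [c, c] @ rev q"]) simp_all
qed

end

section \<open>Relators coming from a permutation group\<close>

definition relator_words :: "nat \<Rightarrow> (nat \<Rightarrow> nat) set \<Rightarrow> nat list set" where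
  "relator_words n H = (\<lambda>\<sigma>. map \<sigma> (zword n)) ` H"

context
  fixes n :: nat and H :: "(nat \<Rightarrow> nat) set"
  assumes n3: "n \<ge> 3" and H: "subgroup H (sym_group n)"
begin

lemma H_permutes: "\<sigma> \<in> H \<Longrightarrow> \<sigma> permutes {1..n}"
  using subgroup.subset[OF H] sym_group_carrier by blast

lemma H_id: "id \<in> H"
  using subgroup.one_closed[OF H] by (simp add: sym_group_one)

lemma H_comp: "\<sigma> \<in> H \<Longrightarrow> \<tau> \<in> H \<Longrightarrow> \<sigma> \<circ> \<tau> \<in> H"
  using subgroup.m_closed[OF H] by (simp add: sym_group_mult)

lemma H_inv: "\<sigma> \<in> H \<Longrightarrow> inv' \<sigma> \<in> H"
  using subgroup.m_inv_closed[OF H] H_permutes sym_group_inv_equality sym_group_carrier by metis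

lemma zword_props: "length (zword n) = n" "distinct (zword n)" "set (zword n) = {1..n}"
  "i < n \<Longrightarrow> zword n ! i = Suc i"
  unfolding zword_def by (auto simp del: upt_Suc)

lemma zword_relator: "zword n \<in> relator_words n H"
  unfolding relator_words_def using H_id by (metis image_eqI list.map_id)

lemma relators_H: "relators {1..n} n (relator_words n H)"
proof
  fix a assume "a \<in> relator_words n H"
  then obtain \<sigma> where s: "\<sigma> \<in> H" "a = map \<sigma> (zword n)" unfolding relator_words_def by blast
  have "inj \<sigma>" "\<sigma> ` {1..n} = {1..n}"
    using H_permutes[OF s(1)] permutes_inj permutes_image by blast+
  then show "distinct a \<and> length a = n \<and> set a \<subseteq> {1..n}"
    using s zword_props by (auto simp: distinct_map intro: inj_on_subset)
qed (use n3 in auto)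

lemma relator_set: "a \<in> relator_words n H \<Longrightarrow> set a = {1..n}"
  unfolding relator_words_def using zword_props permutes_image H_permutes by fastforce

lemma relators_rev: "relators {1..n} n (rev ` relator_words n H)"
  using relators_H unfolding relators_def by (simp only: ball_simps image_iff) (metis distinct_rev length_rev set_rev)

lemma scong_iff: "scong n H u v \<longleftrightarrow> wcong (relator_words n H) u v"
proof
  assume "scong n H u v"
  then show "wcong (relator_words n H) u v"
  proof induction
    case (sstep \<sigma> u v)
    then show ?case
      using zword_relator by (intro wcong_context wcong_relators) (auto simp: relator_words_def)
  qed (auto intro: wcong_sym)
next
  assume "wcong (relator_words n H) u v"
  then show "scong n H u v"
  proof induction
    case (step v w)
    then obtain p q \<sigma> \<tau> where "\<sigma> \<in> H" "\<tau> \<in> H" "v = p @ map \<sigma> (zword n) @ q" "w = p @ map \<tau> (zword n) @ q"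
      unfolding rstep_def relator_words_def by blast
    then have "scong n H v w" by (metis scong.sstep scong.ssym scong.strans)
    then show ?case using step.IH scong.strans by blast
  qed (rule scong.srefl)
qed

text \<open>Without transitivity the orbits of \<open>n\<close> and of 1 are proper, so some letter
  never ends a relator and some letter never begins one. A transitive abelian group acts regularly,
  and then the relators and their reversals both satisfy \<open>regular_relators\<close>.\<close>

lemma extendable_relator_words:
  assumes "\<not> transitive_on n H \<or> ((\<forall>\<sigma>\<in>H. \<forall>\<tau>\<in>H. \<sigma> \<circ> \<tau> = \<tau> \<circ> \<sigma>) \<and> long_cycle n \<notin> H)"
  shows "extendable {1..n} (relator_words n H)" "extendable {1..n} (rev ` relator_words n H)"
proof -
  have ends: "last (map \<sigma> (zword n)) = \<sigma> n" "hd (map \<sigma> (zword n)) = \<sigma> 1" for \<sigma>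
  proof -
    show "last (map \<sigma> (zword n)) = \<sigma> n" unfolding zword_def using n3 by simp
    have "zword n = 1 # [Suc 1..<n + 1]" unfolding zword_def using n3 by (intro upt_conv_Cons) simp
    then show "hd (map \<sigma> (zword n)) = \<sigma> 1" by simp
  qed
  have "extendable {1..n} (relator_words n H) \<and> extendable {1..n} (rev ` relator_words n H)"
  proof (cases "transitive_on n H")
    case False
    \<comment> \<open>If the orbit of \<open>k\<close> were everything, going from \<open>i\<close>
      back to \<open>k\<close> and on to \<open>j\<close> would show transitivity.\<close>
    have miss: "\<exists>x\<in>{1..n}. \<forall>\<sigma>\<in>H. \<sigma> k \<noteq> x" if k: "k \<in> {1..n}" for k
    proof (rule ccontr)
      assume "\<not> ?thesis"
      then have all: "\<And>x. x \<in> {1..n} \<Longrightarrow> \<exists>\<sigma>\<in>H. \<sigma> k = x" by blast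
      have "transitive_on n H" unfolding transitive_on_def
      proof (intro ballI)
        fix i j assume "i \<in> {1..n}" "j \<in> {1..n}"
        then obtain \<sigma> \<tau> where s: "\<sigma> \<in> H" "\<sigma> k = i" "\<tau> \<in> H" "\<tau> k = j" using all by meson
        then have "(\<tau> \<circ> inv' \<sigma>) i = j" using H_permutes permutes_inverses(2) by fastforce
        then show "\<exists>\<sigma>\<in>H. \<sigma> i = j" using H_comp H_inv s by blast
      qed
      then show False using False by blast
    qed
    obtain x where x: "x \<in> {1..n}" "\<forall>\<sigma>\<in>H. \<sigma> n \<noteq> x" using miss[of n] n3 by auto
    obtain y where y: "y \<in> {1..n}" "\<forall>\<sigma>\<in>H. \<sigma> 1 \<noteq> y" using miss[of 1] n3 by auto
    have "extendable {1..n} (relator_words n H)"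
    proof (rule relators.extendable_nonlast[OF relators_H x(1)])
      fix a assume "a \<in> relator_words n H"
      then obtain \<sigma> where "\<sigma> \<in> H" "a = map \<sigma> (zword n)" unfolding relator_words_def by blast
      then show "last a \<noteq> x" using x(2) ends(1)[of \<sigma>] by simp
    qed
    moreover have "extendable {1..n} (rev ` relator_words n H)"
    proof (rule relators.extendable_nonlast[OF relators_rev y(1)])
      fix a assume "a \<in> rev ` relator_words n H"
      then obtain \<sigma> where "\<sigma> \<in> H" "a = rev (map \<sigma> (zword n))" unfolding relator_words_def by blast
      then show "last a \<noteq> y" using y(2) ends(2)[of \<sigma>] by (simp only: last_rev) blast
    qed
    ultimately show ?thesis by blast
  next
    case True
    then have comm: "\<And>\<sigma> \<tau>. \<sigma> \<in> H \<Longrightarrow> \<tau> \<in> H \<Longrightarrow> \<sigma> \<circ> \<tau> = \<tau> \<circ> \<sigma>" and nlc: "long_cycle n \<notin> H"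
      using assms by blast+
    have tr: "\<exists>\<sigma>\<in>H. \<sigma> i = j" if "i \<in> {1..n}" "j \<in> {1..n}" for i j
      using True that unfolding transitive_on_def by blast
    \<comment> \<open>Two commuting-group elements that agree at \<open>i\<close> agree at every
      \<open>\<rho> i\<close> with \<open>\<rho>\<close> in \<open>H\<close>, hence on the whole
      orbit; outside \<open>{1..n}\<close> both are the identity.\<close>
    have reg: "\<sigma> = \<tau>" if st: "\<sigma> \<in> H" "\<tau> \<in> H" "i \<in> {1..n}" "\<sigma> i = \<tau> i" for \<sigma> \<tau> i
    proof
      fix j
      show "\<sigma> j = \<tau> j"
      proof (cases "j \<in> {1..n}")
        case True
        then obtain \<rho> where r: "\<rho> \<in> H" "\<rho> i = j" using tr st by blast
        then show ?thesis using comm[OF st(1) r(1)] comm[OF st(2) r(1)] st(4) by (metis comp_apply)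
      next
        case False
        then show ?thesis using H_permutes[OF st(1)] H_permutes[OF st(2)] permutes_not_in by metis
      qed
    qed
    \<comment> \<open>Positions count from 0 and letters from 1, so this is an element of
      \<open>H\<close> taking the letter of \<open>zword n\<close> at position \<open>i\<close> to
      the next one. It is meaningful only for \<open>Suc i < n\<close>.\<close>
    define D where "D i = (SOME \<rho>. \<rho> \<in> H \<and> \<rho> (Suc i) = Suc (Suc i))" for i
    have D: "D i \<in> H" "D i (Suc i) = Suc (Suc i)" if "Suc i < n" for i
      using someI_ex[of "\<lambda>\<rho>. \<rho> \<in> H \<and> \<rho> (Suc i) = Suc (Suc i)"] tr[of "Suc i" "Suc (Suc i)"] that
      unfolding D_def by auto
    \<comment> \<open>Commutativity carries the successor rule from \<open>zword n\<close> over to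
      all its images under \<open>H\<close>.\<close>
    have shift: "\<sigma> (Suc (Suc i)) = D i (\<sigma> (Suc i))" if "\<sigma> \<in> H" "Suc i < n" for \<sigma> i
      using comm[OF that(1) D(1)[OF that(2)]] D(2)[OF that(2)] by (metis comp_apply)
    \<comment> \<open>If all \<open>D i\<close> were \<open>D k\<close>, that permutation would send
      each \<open>j < n\<close> to \<open>j + 1\<close>, hence \<open>n\<close> to 1, and the long
      cycle would lie in \<open>H\<close>. The reference index is arbitrary because the relators
      need \<open>n - 2\<close> and their reversals need 0.\<close>
    have nonconst: "\<exists>i. Suc i < n \<and> D i \<noteq> D k" if k: "Suc k < n" for k
    proof (rule ccontr)
      assume "\<not> ?thesis"
      then have "D k (Suc i) = Suc (Suc i)" if "Suc i < n" for i using D(2)[OF that] that by metis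
      then have up: "D k j = j + 1" if "1 \<le> j" "j < n" for j
        using that by (metis Suc_eq_plus1 Suc_pred' less_le_trans zero_less_one)
      have perm: "D k permutes {1..n}" using H_permutes D(1)[OF k] by blast
      have "D k n \<in> {1..n}" using permutes_in_image[OF perm] n3 by simp
      moreover have "D k n \<noteq> j + 1" if "1 \<le> j" "j < n" for j
        using up[OF that] permutes_inj[OF perm] that by (metis injD less_irrefl)
      ultimately have "D k n = 1"
        by (metis Suc_eq_plus1 Suc_le_lessD Suc_pred' atLeastAtMost_iff diff_is_0_eq' le_eq_less_or_eq
            less_one not_less zero_less_diff One_nat_def)
      then have "D k = long_cycle n"
        using up permutes_not_in[OF perm] unfolding long_cycle_def by fastforce
      then show False using nlc D(1)[OF k] by simp
    qed
    have D_perm: "D i permutes {1..n}" if "Suc i < n" for i using H_permutes D(1)[OF that] by blast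
    have nth: "map \<sigma> (zword n) ! i = \<sigma> (Suc i)" "rev (map \<sigma> (zword n)) ! i = \<sigma> (n - i)"
      if "i < n" for \<sigma> :: "nat \<Rightarrow> nat" and i
      using that zword_props by (simp_all add: rev_nth Suc_diff_Suc)
    have rw: "\<exists>\<sigma>\<in>H. a = map \<sigma> (zword n)" if "a \<in> relator_words n H" for a
      using that unfolding relator_words_def by blast
    have wr: "map \<sigma> (zword n) \<in> relator_words n H" if "\<sigma> \<in> H" for \<sigma>
      using that unfolding relator_words_def by blast
    have "regular_relators {1..n} n (relator_words n H) D"
    proof (intro regular_relators.intro[OF relators_H] regular_relators_axioms.intro)
      fix a b assume "a \<in> relator_words n H" "b \<in> relator_words n H" "last a = last b"
      then obtain \<sigma> \<tau> where "\<sigma> \<in> H" "\<tau> \<in> H" "a = map \<sigma> (zword n)" "b = map \<tau> (zword n)"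
        "\<sigma> n = \<tau> n" using rw ends(1) by metis
      then show "a = b" using reg[of \<sigma> \<tau> n] n3 by auto
    next
      fix x assume "x \<in> {1..n}"
      then obtain \<sigma> where "\<sigma> \<in> H" "\<sigma> n = x" using tr[of n x] n3 by auto
      then show "\<exists>a\<in>relator_words n H. last a = x" using wr ends(1) by blast
    next
      fix a i assume "a \<in> relator_words n H" "Suc i < n"
      then show "a ! Suc i = D i (a ! i)" using rw nth(1) shift by (metis Suc_lessD)
    next
      fix i j x assume "Suc i < n" "Suc j < n" "x \<in> {1..n}" "D i x = D j x"
      then show "D i = D j" using reg D(1) by blast
    next
      fix i assume "Suc i < n"
      then show "inj_on (D i) {1..n}" using D_perm permutes_inj_on by blast
    next
      show "\<exists>i. Suc i < n \<and> D i \<noteq> D (n - 2)" using nonconst[of "n - 2"] n3 by auto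
    qed
    \<comment> \<open>Positions \<open>i\<close> and \<open>i + 1\<close> of a reversed relator are
      positions \<open>n - 1 - i\<close> and \<open>n - 2 - i\<close> of the original, so the
      successor map is the inverse of \<open>D (n - 2 - i)\<close>.\<close>
    moreover have "regular_relators {1..n} n (rev ` relator_words n H) (\<lambda>i. inv' (D (n - 2 - i)))"
    proof (intro regular_relators.intro[OF relators_rev] regular_relators_axioms.intro)
      fix a b assume "a \<in> rev ` relator_words n H" "b \<in> rev ` relator_words n H" "last a = last b"
      then obtain \<sigma> \<tau> where st: "\<sigma> \<in> H" "\<tau> \<in> H" "a = rev (map \<sigma> (zword n))" "b = rev (map \<tau> (zword n))"
        unfolding relator_words_def by blast
      then have "\<sigma> 1 = \<tau> 1" using \<open>last a = last b\<close> ends(2) unfolding st(3,4) last_rev by metis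
      with st show "a = b" using reg[of \<sigma> \<tau> 1] n3 by auto
    next
      fix x assume "x \<in> {1..n}"
      then obtain \<sigma> where "\<sigma> \<in> H" "\<sigma> 1 = x" using tr[of 1 x] n3 by auto
      then have "rev (map \<sigma> (zword n)) \<in> rev ` relator_words n H" "last (rev (map \<sigma> (zword n))) = x"
        using wr ends(2)[of \<sigma>] by (blast, simp only: last_rev)
      then show "\<exists>a\<in>rev ` relator_words n H. last a = x" by blast
    next
      fix a i assume "a \<in> rev ` relator_words n H" and i: "Suc i < n"
      then obtain \<sigma> where s: "\<sigma> \<in> H" "a = rev (map \<sigma> (zword n))" using rw by blast
      define k where "k = n - 2 - i"
      have k: "Suc k < n" "n - Suc i = Suc k" "n - i = Suc (Suc k)" using i unfolding k_def by linarith+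
      have "a ! i = D k (a ! Suc i)" using s nth(2)[of i \<sigma>] nth(2)[of "Suc i" \<sigma>] i k shift by simp
      then show "a ! Suc i = inv' (D (n - 2 - i)) (a ! i)"
        using permutes_inverses(2)[OF D_perm[OF k(1)]] unfolding k_def by simp
    next
      fix i j x assume ij: "Suc i < n" "Suc j < n" and x: "x \<in> {1..n}"
        and eq: "inv' (D (n - 2 - i)) x = inv' (D (n - 2 - j)) x"
      have k: "Suc (n - 2 - i) < n" "Suc (n - 2 - j) < n" using ij by linarith+
      let ?y = "inv' (D (n - 2 - i)) x"
      have "?y \<in> {1..n}" using permutes_in_image[OF permutes_inv[OF D_perm[OF k(1)]]] x by blast
      moreover have "D (n - 2 - i) ?y = D (n - 2 - j) ?y"
        using permutes_inverses(1)[OF D_perm[OF k(1)]] permutes_inverses(1)[OF D_perm[OF k(2)]] eq by metis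
      ultimately have "D (n - 2 - i) = D (n - 2 - j)" using reg D(1) k by blast
      then show "inv' (D (n - 2 - i)) = inv' (D (n - 2 - j))" by simp
    next
      fix i assume "Suc i < n"
      then have "Suc (n - 2 - i) < n" by linarith
      then show "inj_on (inv' (D (n - 2 - i))) {1..n}"
        using D_perm permutes_inv permutes_inj_on by blast
    next
      obtain i where i: "Suc i < n" "D i \<noteq> D 0" using nonconst[of 0] n3 by auto
      then have e: "n - 2 - (n - 2 - i) = i" "Suc (n - 2 - i) < n" by linarith+
      have "Suc 0 < n" using n3 by simp
      then have "inv' (inv' (D i)) = D i" "inv' (inv' (D 0)) = D 0"
        using permutes_inv_inv D_perm i(1) by blast+
      then have "inv' (D i) \<noteq> inv' (D 0)" using i(2) by auto
      then show "\<exists>i. Suc i < n \<and> inv' (D (n - 2 - i)) \<noteq> inv' (D (n - 2 - (n - 2)))"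
        using e by (intro exI[of _ "n - 2 - i"]) simp
    qed
    ultimately show ?thesis using regular_relators.extendable_regular by blast
  qed
  then show "extendable {1..n} (relator_words n H)" "extendable {1..n} (rev ` relator_words n H)" by blast+
qed

text \<open>Primeness is the contrapositive of \<open>separating_word\<close>. The ideal is proper
  because forbidden factors are nonempty and congruence preserves length, which keeps the empty word
  outside.\<close>

lemma prime_ideal_hits:
  assumes ext: "extendable {1..n} (relator_words n H)" "extendable {1..n} (rev ` relator_words n H)"
    and adm: "admissible (relator_words n H) F"
  shows "prime_ideal n H {u \<in> words n. hits (relator_words n H) F u}"
proof -
  interpret relators "{1..n}" n "relator_words n H" by (rule relators_H)
  let ?R = "relator_words n H"
  have "hits ?R F (x @ u @ y)" if "hits ?R F u" for u x y
  proof -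
    from that obtain f p q where "f \<in> F" "wcong ?R u (p @ f @ q)" unfolding hits_def by blast
    then have "f \<in> F" "wcong ?R (x @ u @ y) ((x @ p) @ f @ (q @ y))"
      using wcong_context[of ?R u "p @ f @ q" x y] by simp_all
    then show ?thesis unfolding hits_def by blast
  qed
  moreover have "wcong ?R u w \<Longrightarrow> hits ?R F u \<Longrightarrow> hits ?R F w" for u w using hits_cong by blast
  moreover have "[] \<in> words n" unfolding words_def by simp
  moreover have "\<not> hits ?R F []"
  proof
    assume "hits ?R F []"
    then obtain f x y where f: "f \<in> F" "wcong ?R [] (x @ f @ y)" unfolding hits_def by blast
    then have "[] \<in> F" using wcong_length[OF f(2)] by simp
    then obtain ws where "ws \<noteq> []" "set ws \<subseteq> ?R" "concat ws = []"
      using adm unfolding admissible_def by fastforce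
    then show False using rel_ne by (metis concat_eq_Nil_conv last_in_set subsetD)
  qed
  moreover have "u \<in> words n \<Longrightarrow> v \<in> words n \<Longrightarrow> \<forall>s\<in>words n. hits ?R F (u @ s @ v) \<Longrightarrow>
      hits ?R F u \<or> hits ?R F v" for u v
    using separating_word[OF ext adm] unfolding words_def by blast
  ultimately show ?thesis
    unfolding prime_ideal_def is_ideal_def scong_iff by (auto simp: words_def)
qed

text \<open>Every relator uses exactly the letters in \<open>{1..n}\<close>, so a word congruent to
  one over this alphabet is again over it, and the cofactors \<open>x\<close> and \<open>y\<close>
  lie in \<open>words n\<close> automatically.\<close>

lemma pideal_hits:
  "pideal n H f = {u \<in> words n. hits (relator_words n H) {f} u}"
proof -
  have "x \<in> words n \<and> y \<in> words n" if "u \<in> words n" "wcong (relator_words n H) u (x @ f @ y)" for u x y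
    using wcong_lists[OF relator_set that(2)] that(1) unfolding words_def by auto
  then show ?thesis unfolding pideal_def hits_def scong_iff by blast
qed

end

theorem theorem4p6:
  fixes n :: nat and H :: "(nat \<Rightarrow> nat) set"
  assumes "n \<ge> 3"
    and "subgroup H (sym_group n)"
    and "\<not> transitive_on n H \<or>
         ((\<forall>\<sigma> \<in> H. \<forall>\<tau> \<in> H. \<sigma> \<circ> \<tau> = \<tau> \<circ> \<sigma>) \<and> long_cycle n \<notin> H)"
  shows
    "(\<forall>(r::nat) (ms::nat \<Rightarrow> nat) (is::nat \<Rightarrow> nat).
        r \<ge> 1 \<and> (\<forall>j \<in> {1..r}. ms j \<ge> 3 \<and> 1 \<le> is j \<and> is j \<le> n) \<longrightarrow>
        prime_ideal n H (\<Union>j \<in> {1..r}. pideal n H (replicate (ms j) (is j))))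
   \<and> (\<forall>m::nat. m \<ge> 1 \<longrightarrow> prime_ideal n H (pideal n H (concat (replicate m (zword n)))))
   \<and> (\<forall>(r::nat) (ms::nat \<Rightarrow> nat) (is::nat \<Rightarrow> nat) (m::nat).
        r \<ge> 1 \<and> (\<forall>j \<in> {1..r}. ms j \<ge> 3 \<and> 1 \<le> is j \<and> is j \<le> n) \<and> m \<ge> 1 \<longrightarrow>
        prime_ideal n H (pideal n H (concat (replicate m (zword n)))
                         \<union> (\<Union>j \<in> {1..r}. pideal n H (replicate (ms j) (is j)))))"
proof -
  let ?R = "relator_words n H"
  note prime = prime_ideal_hits[OF assms(1,2) extendable_relator_words[OF assms]]
  note hits_eq = pideal_hits[OF assms(1,2)]
  have adm_pow: "admissible ?R ((\<lambda>j. replicate (ms j) (is j)) ` {1..r})"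
    if "\<forall>j\<in>{1..r}. ms j \<ge> 3 \<and> 1 \<le> is j \<and> is j \<le> n" for r and ms "is" :: "nat \<Rightarrow> nat"
    using that unfolding admissible_def by blast
  have adm_z: "admissible ?R {concat (replicate m (zword n))}" if "m \<ge> 1" for m
    using that zword_relator[OF assms(1,2)] unfolding admissible_def
    by (auto intro!: exI[of _ "replicate m (zword n)"])
  \<comment> \<open>A union of such ideals corresponds to the union of the sets of forbidden
    factors, so all three claims are instances of \<open>prime_ideal_hits\<close>.\<close>
  have pow_eq: "(\<Union>j\<in>{1..r}. pideal n H (replicate (ms j) (is j)))
      = {u \<in> words n. hits ?R ((\<lambda>j. replicate (ms j) (is j)) ` {1..r}) u}" for r and ms "is" :: "nat \<Rightarrow> nat"
    unfolding hits_eq hits_def by auto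
  have un_eq: "{u \<in> words n. hits ?R F u} \<union> {u \<in> words n. hits ?R G u} = {u \<in> words n. hits ?R (F \<union> G) u}" for F G
    unfolding hits_def by auto
  have adm_un: "admissible ?R F \<Longrightarrow> admissible ?R G \<Longrightarrow> admissible ?R (F \<union> G)" for F G
    unfolding admissible_def by blast
  show ?thesis
    unfolding pow_eq unfolding hits_eq un_eq
    by (intro conjI allI impI prime adm_un adm_pow adm_z) simp_all
qed

end
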